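(* For every prime $p$ with $p \equiv 1 \pmod 4$, the Paley graph $Pal_p$ satisfies $$\delta_{loc}(Pal_p) \geq \sqrt{p} - \tfrac{3}{2}.$$
   Context: All graphs are finite, simple and undirected. For a prime $p \equiv 1 \pmod 4$, the Paley graph $Pal_p$ has vertex set $\mathbb{F}_p$, and two distinct vertices $i,j$ are adjacent if and only if $i-j$ is a (nonzero) square in $\mathbb{F}_p$. The local complementation of a graph $G$ at a vertex $u$ is the graph $G * u = G \,\Delta\, K_{\mathcal{N}(u)}$, i.e. the edge set is replaced by its symmetric difference with the edge set of the complete graph on the neighborhood $\mathcal{N}(u)$ of $u$. Two graphs are locally equivalent, $G \equiv_{LC} G'$, if one can be obtained from the other by a finite sequence of local complementations. The local minimum degree is $\delta_{loc}(G) = \min\{\delta(G') : G' \equiv_{LC} G\}$, where $\delta(G')$ denotes the minimum degree of $G'$. *)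

theory Defs
  imports Complex_Main "HOL-Library.Ramsey" "HOL-Number_Theory.Number_Theory"
begin

text \<open>An edge is a two-element set of vertices; \<open>[A]\<^bsup>2\<^esup>\<close> is the library's notation for the set of
  all two-element subsets of \<open>A\<close>, that is, the edge set of the complete graph on \<open>A\<close>.\<close>

record 'a ugraph =
  verts :: "'a set"
  edges :: "'a set set"

definition finite_simple_graph :: "'a ugraph \<Rightarrow> bool" where
  "finite_simple_graph G \<longleftrightarrow> finite (verts G) \<and> edges G \<subseteq> [verts G]\<^bsup>2\<^esup>"

definition neighborhood :: "'a ugraph \<Rightarrow> 'a \<Rightarrow> 'a set" where
  "neighborhood G u = {v \<in> verts G. {u, v} \<in> edges G}"

definition degree :: "'a ugraph \<Rightarrow> 'a \<Rightarrow> nat" where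
  "degree G v = card (neighborhood G v)"

definition min_degree :: "'a ugraph \<Rightarrow> nat" where
  "min_degree G = Min (degree G ` verts G)"

definition local_complement :: "'a ugraph \<Rightarrow> 'a \<Rightarrow> 'a ugraph" where
  "local_complement G u =
     \<lparr>verts = verts G, edges = sym_diff (edges G) ([neighborhood G u]\<^bsup>2\<^esup>)\<rparr>"

inductive locally_equivalent :: "'a ugraph \<Rightarrow> 'a ugraph \<Rightarrow> bool" where
  refl: "locally_equivalent G G"
| step: "locally_equivalent G H \<Longrightarrow> u \<in> verts H \<Longrightarrow> locally_equivalent G (local_complement H u)"

text \<open>The infimum in \<^typ>\<open>nat\<close> is a minimum, since the set is nonempty; see
  \<open>local_min_degree_attained\<close> and \<open>local_min_degree_le\<close> below.\<close>

definition local_min_degree :: "'a ugraph \<Rightarrow> nat" where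
  "local_min_degree G = Inf {min_degree H | H. locally_equivalent G H}"

text \<open>An unordered pair is an edge if the difference taken in one of the two orders is a square.
  For primes congruent to 1 modulo 4 the order is irrelevant (\<open>paley_adjacent_iff\<close>).\<close>

definition paley_graph :: "nat \<Rightarrow> int ugraph" where
  "paley_graph p = (let R = residue_ring (int p) in
     \<lparr>verts = carrier R,
      edges = {{i, j} | i j. i \<in> carrier R \<and> j \<in> carrier R \<and> i \<noteq> j \<and>
                 (\<exists>y \<in> carrier R. i \<ominus>\<^bsub>R\<^esub> j = y \<otimes>\<^bsub>R\<^esub> y)}\<rparr>)"

lemma verts_local_complement [simp]: "verts (local_complement G u) = verts G"
  by (simp add: local_complement_def)

lemma finite_simple_graph_local_complement:
  assumes "finite_simple_graph G"
  shows "finite_simple_graph (local_complement G u)"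
proof -
  have "[neighborhood G u]\<^bsup>2\<^esup> \<subseteq> [verts G]\<^bsup>2\<^esup>"
    by (rule nsets_mono) (auto simp: neighborhood_def)
  with assms show ?thesis
    by (auto simp: finite_simple_graph_def local_complement_def)
qed

lemma locally_equivalent_finite_simple_graph:
  assumes "locally_equivalent G H" "finite_simple_graph G"
  shows "finite_simple_graph H" "verts H = verts G"
  using assms by (induction) (auto simp: finite_simple_graph_local_complement)

lemma local_min_degree_attained:
  obtains H where "locally_equivalent G H" "min_degree H = local_min_degree G"
proof -
  have "{min_degree H | H. locally_equivalent G H} \<noteq> {}"
    using locally_equivalent.refl by blast
  from Inf_nat_def1[OF this] show ?thesis
    using that by (auto simp: local_min_degree_def)
qed

lemma local_min_degree_le:
  assumes "locally_equivalent G H"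
  shows "local_min_degree G \<le> min_degree H"
  unfolding local_min_degree_def by (rule wellorder_Inf_le1) (use assms in blast)

lemma local_complement_involution:
  assumes "finite_simple_graph G"
  shows "local_complement (local_complement G u) u = G"
proof -
  have "{u, v} \<notin> [neighborhood G u]\<^bsup>2\<^esup>" for v
    using assms by (auto simp: nsets_def finite_simple_graph_def neighborhood_def)
  hence "neighborhood (local_complement G u) u = neighborhood G u"
    by (auto simp: neighborhood_def local_complement_def)
  thus ?thesis
    by (cases G) (auto simp: local_complement_def)
qed

lemma residue_ring_square_iff:
  assumes "p > 1" "i \<in> carrier (residue_ring (int p))" "j \<in> carrier (residue_ring (int p))"
  shows "(\<exists>y \<in> carrier (residue_ring (int p)).
            i \<ominus>\<^bsub>residue_ring (int p)\<^esub> j = y \<otimes>\<^bsub>residue_ring (int p)\<^esub> y)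
         \<longleftrightarrow> QuadRes (int p) (i - j)"
proof -
  interpret residues "int p" "residue_ring (int p)"
    by unfold_locales (use assms in auto)
  have diff: "i \<ominus>\<^bsub>residue_ring (int p)\<^esub> j = (i - j) mod int p"
    by (simp add: a_minus_def res_neg_eq res_add_eq mod_simps)
  show ?thesis
  proof
    assume "\<exists>y \<in> carrier (residue_ring (int p)).
              i \<ominus>\<^bsub>residue_ring (int p)\<^esub> j = y \<otimes>\<^bsub>residue_ring (int p)\<^esub> y"
    thus "QuadRes (int p) (i - j)"
      by (auto simp: QuadRes_def cong_def diff res_mult_eq power2_eq_square)
  next
    assume "QuadRes (int p) (i - j)"
    then obtain y where "y\<^sup>2 mod int p = (i - j) mod int p"
      by (auto simp: QuadRes_def cong_def)
    hence "i \<ominus>\<^bsub>residue_ring (int p)\<^esub> j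
        = (y mod int p) \<otimes>\<^bsub>residue_ring (int p)\<^esub> (y mod int p)"
      by (simp add: diff res_mult_eq power2_eq_square mod_simps)
    moreover have "y mod int p \<in> carrier (residue_ring (int p))"
      by (rule mod_in_carrier)
    ultimately show "\<exists>y \<in> carrier (residue_ring (int p)).
        i \<ominus>\<^bsub>residue_ring (int p)\<^esub> j = y \<otimes>\<^bsub>residue_ring (int p)\<^esub> y" by blast
  qed
qed

lemma verts_paley_graph: "verts (paley_graph p) = {0..<int p}"
  by (auto simp: paley_graph_def residue_ring_def Let_def)

lemma finite_simple_graph_paley: "finite_simple_graph (paley_graph p)"
  by (auto simp: finite_simple_graph_def paley_graph_def residue_ring_def Let_def nsets_def card_insert_if)

lemma QuadRes_minus_one:
  assumes "prime p" "[p = 1] (mod 4)"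
  shows "QuadRes (int p) (- 1)"
proof (rule ccontr)
  assume not: "\<not> QuadRes (int p) (- 1)"
  have mod: "p mod 4 = 1" using assms(2) by (simp add: cong_def)
  hence "p \<noteq> 2" by auto
  with prime_gt_1_nat[OF assms(1)] have p: "p > 2" by linarith
  from mod have "even ((p - 1) div 2)" by presburger
  hence "[Legendre (- 1) (int p) = 1] (mod int p)"
    using euler_criterion[OF assms(1) p, of "- 1"] by simp
  moreover have "Legendre (- 1) (int p) = - 1"
    using not p by (auto simp: Legendre_def cong_0_iff)
  ultimately have "int p dvd 2"
    by (simp add: cong_iff_dvd_diff)
  with p show False by (auto dest: zdvd_imp_le)
qed

lemma paley_adjacent_iff:
  assumes "prime p" "[p = 1] (mod 4)" "i \<in> verts (paley_graph p)" "j \<in> verts (paley_graph p)"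
  shows "{i, j} \<in> edges (paley_graph p) \<longleftrightarrow> i \<noteq> j \<and> QuadRes (int p) (i - j)"
proof -
  have p: "p > 1" using assms(1) prime_gt_1_nat by blast
  have sym: "QuadRes (int p) (j - i)" if "QuadRes (int p) (i - j)" for i j
  proof -
    from that obtain y where y: "[y\<^sup>2 = i - j] (mod int p)" by (auto simp: QuadRes_def)
    from QuadRes_minus_one[OF assms(1,2)] obtain z where z: "[z\<^sup>2 = - 1] (mod int p)"
      by (auto simp: QuadRes_def)
    from cong_mult[OF z y] have "[(z * y)\<^sup>2 = j - i] (mod int p)"
      by (simp add: power_mult_distrib)
    thus ?thesis unfolding QuadRes_def by blast
  qed
  have car: "i \<in> carrier (residue_ring (int p))" "j \<in> carrier (residue_ring (int p))"
    using assms(3,4) by (auto simp: paley_graph_def Let_def)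
  show ?thesis
  proof
    assume "{i, j} \<in> edges (paley_graph p)"
    thus "i \<noteq> j \<and> QuadRes (int p) (i - j)"
      using residue_ring_square_iff[OF p] sym
      by (auto simp: paley_graph_def Let_def doubleton_eq_iff)
  next
    assume "i \<noteq> j \<and> QuadRes (int p) (i - j)"
    moreover from this have "\<exists>y \<in> carrier (residue_ring (int p)).
        i \<ominus>\<^bsub>residue_ring (int p)\<^esub> j = y \<otimes>\<^bsub>residue_ring (int p)\<^esub> y"
      using residue_ring_square_iff[OF p car] by blast
    ultimately show "{i, j} \<in> edges (paley_graph p)"
      using car unfolding paley_graph_def Let_def ugraph.simps by blast
  qed
qed

end

theory Submission
  imports Defs
begin

text \<open>A closed neighbourhood of a vertex in a graph locally equivalent to \<open>G\<close> equals
  \<open>D \<union> Odd(D)\<close> for some nonempty \<open>D\<close> in \<open>G\<close>, where \<open>Odd(D)\<close> consists of the vertices with an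
  odd number of neighbours in \<open>D\<close>. In the Paley graph put \<open>S = D \<union> Odd(D)\<close>; off \<open>S\<close> the product of
  the Legendre symbols of \<open>x - d\<close> over \<open>d \<in> D\<close> has constant sign. If \<open>|D|\<close> is odd, an argument
  modelled on the square root bound for quadratic residue codes shows that \<open>S + n S\<close> is the whole
  field for every nonresidue \<open>n\<close>, so that \<open>|S|\<^sup>2 \<ge> p\<close>. A linear fractional substitution
  reduces the even case to the odd one.\<close>

section \<open>Local sets\<close>

definition odd_neighborhood :: "'a ugraph \<Rightarrow> 'a set \<Rightarrow> 'a set" where
  "odd_neighborhood G D = {v \<in> verts G. odd (card (neighborhood G v \<inter> D))}"

lemma odd_card_sym_diff_iff:
  assumes "finite A" "finite B"
  shows "odd (card (sym_diff A B)) \<longleftrightarrow> odd (card A) \<noteq> odd (card B)"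
proof -
  have "card A = card (A - B) + card (A \<inter> B)" "card B = card (B - A) + card (A \<inter> B)"
    using assms by (auto simp: Int_commute card_Diff_subset_Int card_mono)
  moreover have "card (sym_diff A B) = card (A - B) + card (B - A)"
    using assms by (intro card_Un_disjoint) auto
  ultimately show ?thesis by presburger
qed

lemma not_in_own_neighborhood:
  "finite_simple_graph G \<Longrightarrow> v \<notin> neighborhood G v"
  by (auto simp: finite_simple_graph_def neighborhood_def nsets_def)

lemma neighborhood_sym:
  "v \<in> verts G \<Longrightarrow> w \<in> neighborhood G v \<Longrightarrow> v \<in> neighborhood G w"
  by (auto simp: neighborhood_def insert_commute)

lemma neighborhood_local_complement:
  "neighborhood (local_complement G u) v =
     (if v \<in> neighborhood G u
      then sym_diff (neighborhood G v) (neighborhood G u - {v}) else neighborhood G v)"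
  by (auto simp: neighborhood_def local_complement_def nsets_def card_insert_if)

text \<open>If an odd number of neighbours of \<open>u\<close> lie in \<open>D\<close>, then \<open>u\<close> belongs to the odd neighbourhood
  both before and after, so that toggling the membership of \<open>u\<close> in \<open>D\<close> does not affect the union.\<close>

lemma local_set_local_complement:
  assumes G: "finite_simple_graph G" and u: "u \<in> verts G"
    and D: "D \<subseteq> verts G" "D \<noteq> {}"
  shows "\<exists>D' \<subseteq> verts G. D' \<noteq> {} \<and>
           D' \<union> odd_neighborhood (local_complement G u) D' = D \<union> odd_neighborhood G D"
proof -
  let ?N = "neighborhood G" and ?H = "local_complement G u"
  let ?N' = "neighborhood ?H"
  have "finite (verts G)" using G by (simp add: finite_simple_graph_def)
  hence fin: "finite D" "finite (?N v)" for v
    using D by (auto simp: neighborhood_def intro: finite_subset)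
  have uN: "u \<notin> ?N u" using G by (rule not_in_own_neighborhood)
  have N': "odd (card (?N' w \<inter> D)) \<longleftrightarrow>
      odd (card (?N w \<inter> D)) \<noteq> (w \<in> ?N u \<and> odd (card (?N u \<inter> D)))" if "w \<notin> D" for w
  proof (cases "w \<in> ?N u")
    case True
    \<comment> \<open>Removing \<open>w\<close> from \<open>?N u\<close> changes nothing inside
      \<open>D\<close>, because \<open>w\<close> lies outside \<open>D\<close>.\<close>
    have "?N' w \<inter> D = sym_diff (?N w \<inter> D) (?N u \<inter> D)"
      using True that by (auto simp: neighborhood_local_complement)
    thus ?thesis using True fin by (simp add: odd_card_sym_diff_iff)
  qed (simp add: neighborhood_local_complement)
  show ?thesis
  proof (cases "odd (card (?N u \<inter> D))")
    case False
    hence "D \<union> odd_neighborhood ?H D = D \<union> odd_neighborhood G D"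
      using N' by (auto simp: odd_neighborhood_def)
    thus ?thesis using D by blast
  next
    case True
    define D' where "D' = sym_diff D {u}"
    \<comment> \<open>\<open>D = {u}\<close> would leave no neighbour of \<open>u\<close> in
      \<open>D\<close>, contradicting odd parity; hence toggling \<open>u\<close> cannot empty
      \<open>D\<close>.\<close>
    have "D \<noteq> {u}" using True uN by auto
    hence "D' \<noteq> {}" "D' \<subseteq> verts G" using D u by (auto simp: D'_def)
    have N'u: "?N' u = ?N u" using uN by (simp add: neighborhood_local_complement)
    moreover have "?N u \<inter> D' = ?N u \<inter> D" using uN by (auto simp: D'_def)
    ultimately have uodd: "u \<in> odd_neighborhood G D" "u \<in> odd_neighborhood ?H D'"
      using True u by (auto simp: odd_neighborhood_def)
    have "w \<in> odd_neighborhood ?H D' \<longleftrightarrow> w \<in> odd_neighborhood G D"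
      if w: "w \<in> verts G" "w \<noteq> u" "w \<notin> D" for w
    proof -
      have "u \<in> ?N' w \<longleftrightarrow> w \<in> ?N u"
        using neighborhood_sym[of w ?H u] neighborhood_sym[of u ?H w] N'u u w by auto
      moreover have "?N' w \<inter> D' = sym_diff (?N' w \<inter> D) (?N' w \<inter> {u})"
        by (auto simp: D'_def)
      moreover have "finite (?N' w)"
        using fin by (simp add: neighborhood_local_complement)
      moreover have "?N' w \<inter> {u} = (if u \<in> ?N' w then {u} else {})" by auto
      \<comment> \<open>Toggling \<open>u\<close> flips the parity exactly at the neighbours of
        \<open>u\<close>, which cancels the flip recorded in \<open>N'\<close>.\<close>
      ultimately have "odd (card (?N' w \<inter> D')) \<longleftrightarrow> odd (card (?N' w \<inter> D)) \<noteq> (w \<in> ?N u)"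
        using fin by (simp add: odd_card_sym_diff_iff)
      thus ?thesis using N'[OF w(3)] True w by (auto simp: odd_neighborhood_def)
    qed
    hence "D' \<union> odd_neighborhood ?H D' = D \<union> odd_neighborhood G D"
      using uodd by (auto simp: D'_def odd_neighborhood_def)
    thus ?thesis using \<open>D' \<noteq> {}\<close> \<open>D' \<subseteq> verts G\<close> by blast
  qed
qed

text \<open>Local complementation is an involution, so each step can be undone by another one at the
  same vertex, and \<open>D\<close> is pulled back from \<open>H\<close> to \<open>G\<close> with
  its union unchanged.\<close>

lemma local_set_locally_equivalent:
  assumes "locally_equivalent G H" "finite_simple_graph G" "D \<subseteq> verts H" "D \<noteq> {}"
  shows "\<exists>D' \<subseteq> verts G. D' \<noteq> {} \<and> D' \<union> odd_neighborhood G D' = D \<union> odd_neighborhood H D"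
  using assms
proof (induction arbitrary: D)
  case (step G H u)
  have H: "finite_simple_graph H"
    using step.hyps step.prems by (auto dest: locally_equivalent_finite_simple_graph)
  obtain D1 where "D1 \<subseteq> verts H" "D1 \<noteq> {}"
    "D1 \<union> odd_neighborhood H D1 = D \<union> odd_neighborhood (local_complement H u) D"
    using local_set_local_complement[of "local_complement H u" u D] step.prems step.hyps(2) H
    by (auto simp: local_complement_involution finite_simple_graph_local_complement)
  thus ?case using step.IH[of D1] step.prems by simp
qed blast

text \<open>Pull back \<open>{v}\<close>, where \<open>v\<close> has minimum degree in a graph
  attaining the local minimum. Its union is the closed neighbourhood of \<open>v\<close>; the added
  1 counts \<open>v\<close> itself.\<close>

lemma local_set_of_local_min_degree:
  assumes G: "finite_simple_graph G" and ne: "verts G \<noteq> {}"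
  obtains D where "D \<subseteq> verts G" "D \<noteq> {}"
    "card (D \<union> odd_neighborhood G D) = local_min_degree G + 1"
proof -
  obtain H where H: "locally_equivalent G H" "min_degree H = local_min_degree G"
    using local_min_degree_attained .
  have fH: "finite_simple_graph H" and vH: "verts H = verts G"
    using locally_equivalent_finite_simple_graph H(1) G by blast+
  hence fin: "finite (verts H)" by (simp add: finite_simple_graph_def)
  have "min_degree H \<in> degree H ` verts H"
    unfolding min_degree_def using fin ne vH by (intro Min_in) auto
  then obtain v where v: "v \<in> verts H" "card (neighborhood H v) = local_min_degree G"
    using H(2) by (auto simp: degree_def)
  have "neighborhood H w \<inter> {v} = (if v \<in> neighborhood H w then {v} else {})" for w by auto
  hence "odd_neighborhood H {v} = {w \<in> verts H. v \<in> neighborhood H w}"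
    by (auto simp: odd_neighborhood_def)
  also have "\<dots> = neighborhood H v"
    using v(1) neighborhood_sym[of _ H] by (auto simp: neighborhood_def insert_commute)
  finally have "{v} \<union> odd_neighborhood H {v} = insert v (neighborhood H v)" by simp
  moreover have "finite (neighborhood H v)"
    using fin by (auto simp: neighborhood_def)
  ultimately have "card ({v} \<union> odd_neighborhood H {v}) = local_min_degree G + 1"
    using v not_in_own_neighborhood[OF fH] by simp
  thus ?thesis
    using local_set_locally_equivalent[OF H(1) G, of "{v}"] v(1) that
    by (metis empty_subsetI insert_not_empty insert_subset)
qed

section \<open>Products of Legendre symbols\<close>

locale paley_prime =
  fixes p :: nat
  assumes prime: "prime p" and p_mod_4: "[p = 1] (mod 4)"
begin

section \<open>The quadratic character\<close>

abbreviation chi :: "int \<Rightarrow> int" where "chi a \<equiv> Legendre a (int p)"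

lemma p_gt_2: "p > 2"
proof -
  have "p \<noteq> 2" using p_mod_4 by (auto simp: cong_def)
  thus ?thesis using prime_gt_1_nat[OF prime] by linarith
qed

lemma chi_cong: "[a = b] (mod int p) \<Longrightarrow> chi a = chi b"
  by (simp add: Legendre_def QuadRes_def cong_def)

lemma chi_eq_0_iff: "chi a = 0 \<longleftrightarrow> int p dvd a"
  by (simp add: Legendre_def cong_0_iff)

lemma chi_cases: "chi a = 0 \<or> chi a = 1 \<or> chi a = - 1"
  by (simp add: Legendre_def)

text \<open>Euler's criterion gives the congruence modulo \<open>p\<close>; the two sides differ by
  at most 2, which is less than \<open>p\<close>, so they are equal.\<close>

lemma chi_mult: "chi (a * b) = chi a * chi b"
proof -
  note ec = euler_criterion[OF prime p_gt_2]
  have "[chi (a * b) = chi a * chi b] (mod int p)"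
    using cong_mult[OF ec[of a] ec[of b]] ec[of "a * b"]
    by (metis cong_sym cong_trans power_mult_distrib)
  hence "int p dvd chi (a * b) - chi a * chi b" by (simp add: cong_iff_dvd_diff)
  moreover have "\<bar>chi (a * b) - chi a * chi b\<bar> < int p"
    using chi_cases[of "a * b"] chi_cases[of a] chi_cases[of b] p_gt_2 by auto
  ultimately show ?thesis using zdvd_imp_le[of "int p" "\<bar>chi (a * b) - chi a * chi b\<bar>"] by force
qed

lemma chi_1 [simp]: "chi 1 = 1"
proof -
  have "QuadRes (int p) 1" unfolding QuadRes_def by (rule exI[of _ 1]) simp
  thus ?thesis using p_gt_2 by (simp add: Legendre_def cong_0_iff)
qed

lemma chi_minus [simp]: "chi (- a) = chi a"
proof -
  have "chi (- 1) = 1"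
    using QuadRes_minus_one[OF prime p_mod_4] p_gt_2 by (simp add: Legendre_def cong_0_iff)
  thus ?thesis using chi_mult[of "- 1" a] by simp
qed

lemma chi_diff_commute: "chi (a - b) = chi (b - a)"
  using chi_minus[of "a - b"] by simp

text \<open>Squaring identifies 1 and \<open>p - 1\<close>, which differ as \<open>p > 2\<close>;
  being non-injective on the finite set of nonzero residues, it cannot cover that set.\<close>

lemma exists_nonresidue: obtains n where "chi n = - 1"
proof -
  let ?A = "{1..<int p}" and ?f = "\<lambda>y. y\<^sup>2 mod int p"
  have "?f 1 = ?f (int p - 1)"
    unfolding mod_eq_dvd_iff
    by (rule dvdI[of _ _ "2 - int p"]) (simp add: power2_eq_square algebra_simps)
  hence "\<not> inj_on ?f ?A"
    using p_gt_2 inj_onD[of ?f ?A 1 "int p - 1"] by auto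
  moreover have "finite ?A" by simp
  ultimately have "\<not> ?A \<subseteq> ?f ` ?A"
    using finite_surj_inj by blast
  then obtain n where n: "n \<in> ?A" "n \<notin> ?f ` ?A" by blast
  have nd: "\<not> int p dvd n" using n(1) zdvd_imp_le[of "int p" n] by auto
  have "\<not> QuadRes (int p) n"
  proof
    assume "QuadRes (int p) n"
    then obtain y where y: "[y\<^sup>2 = n] (mod int p)" by (auto simp: QuadRes_def)
    define z where "z = y mod int p"
    have "n = ?f z" using y n(1) by (simp add: z_def cong_def power_mod)
    moreover have "0 \<le> z" "z < int p" using p_gt_2 by (simp_all add: z_def)
    moreover have "z \<noteq> 0" using calculation(1) n(1) by auto
    ultimately have "n = ?f z" "z \<in> ?A" by auto
    thus False using n(2) by blast
  qed
  thus ?thesis using that[of n] nd by (simp add: Legendre_def cong_0_iff)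
qed

section \<open>Inverses modulo \<open>p\<close>\<close>

definition inv_mod :: "int \<Rightarrow> int" where
  "inv_mod a = modular_inverse (int p) a mod int p"

lemma inv_mod_range: "inv_mod a \<in> {0..<int p}"
  using p_gt_2 by (simp add: inv_mod_def)

lemma inv_mod_cong: "\<not> int p dvd a \<Longrightarrow> [a * inv_mod a = 1] (mod int p)"
  using cong_modular_inverse1[of a "int p"] prime_imp_coprime[of "int p" a] prime
  by (simp add: inv_mod_def cong_def mod_mult_right_eq coprime_commute)

lemma inv_mod_not_dvd: "\<not> int p dvd a \<Longrightarrow> \<not> int p dvd inv_mod a"
  using inv_mod_cong[of a] p_gt_2 cong_dvd_iff[of "a * inv_mod a" 1 "int p"] by auto

lemma chi_inv_mod:
  assumes "\<not> int p dvd a" shows "chi (inv_mod a) = chi a"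
proof -
  have "chi a * chi (inv_mod a) = 1"
    using chi_cong[OF inv_mod_cong[OF assms]] by (simp add: chi_mult)
  thus ?thesis using chi_cases[of a] by auto
qed

lemma dvd_diff_range:
  assumes "a \<in> {0..<int p}" "b \<in> {0..<int p}" shows "int p dvd a - b \<longleftrightarrow> a = b"
  using assms by (auto simp: mod_eq_dvd_iff[symmetric])

section \<open>Square root bounds for sets off which a character product is constant\<close>

definition chi_prod :: "int set \<Rightarrow> int \<Rightarrow> int" where
  "chi_prod D x = (\<Prod>d\<in>D. chi (x - d))"

lemma chi_prod_mod: "chi_prod D (x mod int p) = chi_prod D x"
  unfolding chi_prod_def by (rule prod.cong) (auto intro!: chi_cong simp: cong_def mod_diff_left_eq)

text \<open>For a nonresidue \<open>n\<close> and \<open>c \<notin> S + n S\<close>, evaluating the product of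
  \<open>chi (d - (c - n d'))\<close> over all \<open>d, d' \<in> D\<close> by rows and by columns gives opposite signs.\<close>

lemma square_root_bound_odd:
  assumes S: "S \<subseteq> {0..<int p}" and D: "D \<subseteq> S" "odd (card D)"
    and eps: "eps = 1 \<or> eps = - 1"
    and off: "\<And>x. x \<in> {0..<int p} \<Longrightarrow> x \<notin> S \<Longrightarrow> chi_prod D x = eps"
  shows "p \<le> card S ^ 2"
proof (rule ccontr)
  assume less: "\<not> p \<le> card S ^ 2"
  have finS: "finite S" using S finite_subset by blast
  obtain n where n: "chi n = - 1" using exists_nonresidue .
  hence ndvd: "\<not> int p dvd n" using chi_eq_0_iff[of n] by simp
  \<comment> \<open>The image of \<open>f\<close> on \<open>S \<times> S\<close> is
    \<open>S + n S\<close> modulo \<open>p\<close>; there are fewer than \<open>p\<close> pairs, so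
    some \<open>c\<close> is missed.\<close>
  define f where "f = (\<lambda>(s, t). (s + n * t) mod int p)"
  have "card (f ` (S \<times> S)) \<le> card (S \<times> S)" using finS by (intro card_image_le) simp
  also have "\<dots> < card {0..<int p}" using less by (simp add: card_cartesian_product power2_eq_square)
  finally have "\<not> {0..<int p} \<subseteq> f ` (S \<times> S)"
    using card_mono[of "f ` (S \<times> S)" "{0..<int p}"] finS by fastforce
  then obtain c where c: "c \<in> {0..<int p}" "c \<notin> f ` (S \<times> S)" by blast
  have cST: False if "s \<in> S" "t \<in> S" "[c = s + n * t] (mod int p)" for s t
    using c that by (force simp: f_def cong_def)
  have offx: "chi_prod D x = eps" if "x mod int p \<notin> S" for x
    using off[of "x mod int p"] that p_gt_2 by (simp add: chi_prod_mod)
  have row: "(\<Prod>d\<in>D. chi (d - (c - n * t))) = eps" if t: "t \<in> D" for t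
  proof -
    have "(c - n * t) mod int p \<notin> S"
    proof
      assume "(c - n * t) mod int p \<in> S"
      moreover have "[c = (c - n * t) mod int p + n * t] (mod int p)"
        by (simp add: cong_def mod_simps)
      ultimately show False using cST t D by blast
    qed
    from offx[OF this] show ?thesis
      by (simp add: chi_prod_def chi_diff_commute[of _ "c - n * t"])
  qed
  have col: "(\<Prod>t\<in>D. chi (d - (c - n * t))) = - eps" if d: "d \<in> D" for d
  proof -
    \<comment> \<open>The solution of \<open>c = d + n * y\<close> modulo \<open>p\<close>; if it
      lay in \<open>S\<close> modulo \<open>p\<close>, then \<open>c\<close> would lie in
      \<open>S + n S\<close>.\<close>
    define y where "y = (c - d) * inv_mod n"
    have "[n * y = (c - d) * (n * inv_mod n)] (mod int p)"
      by (simp add: y_def mult_ac)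
    also have "[(c - d) * (n * inv_mod n) = (c - d) * 1] (mod int p)"
      by (intro cong_mult cong_refl inv_mod_cong ndvd)
    finally have ny: "[n * y = c - d] (mod int p)" by simp
    have "y mod int p \<notin> S"
    proof
      assume "y mod int p \<in> S"
      moreover have "[c = d + n * (y mod int p)] (mod int p)"
      proof -
        have "[n * (y mod int p) = n * y] (mod int p)" by (simp add: cong_def mod_mult_right_eq)
        from cong_add[OF cong_refl[of d] cong_trans[OF this ny]] show ?thesis
          by (simp add: cong_sym_eq)
      qed
      ultimately show False using cST d D by blast
    qed
    from offx[OF this] have e: "(\<Prod>t\<in>D. chi (y - t)) = eps" by (simp add: chi_prod_def)
    \<comment> \<open>The argument is \<open>- n * (y - t)\<close> modulo \<open>p\<close>, so
      \<open>chi n = - 1\<close> contributes one sign for each of the oddly many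
      \<open>t\<close>.\<close>
    have "chi (d - (c - n * t)) = - chi (y - t)" for t
    proof -
      have "[n * (y - t) = - (d - (c - n * t))] (mod int p)"
        using cong_diff[OF ny cong_refl[of "n * t"]] by (simp add: algebra_simps)
      hence "chi (n * (y - t)) = chi (- (d - (c - n * t)))" by (rule chi_cong)
      thus ?thesis by (simp only: chi_mult chi_minus n)
    qed
    hence "(\<Prod>t\<in>D. chi (d - (c - n * t))) = (\<Prod>t\<in>D. - 1 * chi (y - t))" by simp
    also have "\<dots> = (- 1) ^ card D * eps" by (simp only: prod.distrib prod_constant e)
    finally show ?thesis using D(2) by simp
  qed
  have "eps ^ card D = (\<Prod>t\<in>D. \<Prod>d\<in>D. chi (d - (c - n * t)))"
    using row by simp
  also have "\<dots> = (\<Prod>d\<in>D. \<Prod>t\<in>D. chi (d - (c - n * t)))" by (rule prod.swap)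
  also have "\<dots> = (- eps) ^ card D"
    using col by simp
  finally have "eps ^ card D = (- eps) ^ card D" .
  thus False using eps D(2) by auto
qed

text \<open>The substitution \<open>x \<mapsto> 1 / (x - x0)\<close> for some \<open>x0 \<in> D\<close> moves \<open>x0\<close> to infinity, which leaves
  an odd number of points.\<close>

lemma square_root_bound_even:
  assumes S: "S \<subseteq> {0..<int p}" and D: "D \<subseteq> S" "even (card D)" "D \<noteq> {}"
    and off: "\<And>x. x \<in> {0..<int p} \<Longrightarrow> x \<notin> S \<Longrightarrow> chi_prod D x = 1"
  shows "p \<le> (card S - 1) ^ 2"
proof -
  obtain x0 where x0: "x0 \<in> D" using D by blast
  have finS: "finite S" using S finite_subset by blast
  hence finD: "finite D" using D finite_subset by blast
  define E where "E = D - {x0}"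
  define f where "f = (\<lambda>x. inv_mod (x - x0))"
  have x0r: "x0 \<in> {0..<int p}" using x0 D S by blast
  have cE: "odd (card E)" "finite E"
    using D finD x0 card_gt_0_iff[of D] by (auto simp: E_def)
  have nd: "\<not> int p dvd x - x0" if "x \<in> S - {x0}" for x
    using dvd_diff_range[of x x0] that S x0r by blast
  have ES: "E \<subseteq> S - {x0}" using D by (auto simp: E_def)
  have f1: "[(x - x0) * f x = 1] (mod int p)" if "x \<in> S - {x0}" for x
    using inv_mod_cong[OF nd[OF that]] by (simp add: f_def)
  have inj: "inj_on f (S - {x0})"
  proof (rule inj_onI)
    fix x y assume xy: "x \<in> S - {x0}" "y \<in> S - {x0}" "f x = f y"
    have "[(x - x0) * f x - (y - x0) * f x = 1 - 1] (mod int p)"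
      using cong_diff[OF f1[OF xy(1)] f1[OF xy(2)]] xy(3) by simp
    hence "int p dvd (x - y) * f x" by (simp add: cong_0_iff algebra_simps)
    moreover have "\<not> int p dvd f x" using inv_mod_not_dvd nd[OF xy(1)] by (simp add: f_def)
    ultimately have "int p dvd x - y" using prime by (simp add: prime_dvd_mult_iff)
    thus "x = y" using dvd_diff_range[of x y] xy S by blast
  qed
  \<comment> \<open>The sign that the transformed product takes off the image of
    \<open>S - {x0}\<close>.\<close>
  define C where "C = (\<Prod>d\<in>E. chi (d - x0))"
  have C: "C = 1 \<or> C = - 1"
  proof -
    have "\<bar>chi (d - x0)\<bar> = 1" if "d \<in> E" for d
      using nd ES that chi_eq_0_iff[of "d - x0"] chi_cases[of "d - x0"] by auto
    hence "\<bar>C\<bar> = 1" by (simp add: C_def abs_prod)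
    thus ?thesis by auto
  qed
  have "p \<le> card (f ` (S - {x0})) ^ 2"
  proof (rule square_root_bound_odd[of _ "f ` E" C])
    show "f ` (S - {x0}) \<subseteq> {0..<int p}" using inv_mod_range by (auto simp: f_def)
    show "f ` E \<subseteq> f ` (S - {x0})" using ES by blast
    have injE: "inj_on f E" using inj ES by (rule inj_on_subset)
    show "odd (card (f ` E))" using cE by (simp add: card_image injE)
    show "C = 1 \<or> C = - 1" by (rule C)
    fix y assume y: "y \<in> {0..<int p}" "y \<notin> f ` (S - {x0})"
    have cp: "chi_prod (f ` E) y = (\<Prod>d\<in>E. chi (y - f d))"
      by (simp add: chi_prod_def prod.reindex injE)
    show "chi_prod (f ` E) y = C"
    proof (cases "y = 0")
      \<comment> \<open>Here \<open>y = 0\<close> is the image of infinity: no \<open>x\<close>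
        corresponds to it, so the sign is computed directly.\<close>
      case True
      have "chi (f d) = chi (d - x0)" if "d \<in> E" for d
        using chi_inv_mod nd that ES by (auto simp: f_def)
      thus ?thesis using cp True by (simp add: C_def)
    next
      case False
      have ndy: "\<not> int p dvd y" using dvd_diff_range[of y 0] y False p_gt_2 by simp
      define u where "u = inv_mod y"
      have ndu: "\<not> int p dvd u" using inv_mod_not_dvd ndy by (simp add: u_def)
      have yu: "[y * u = 1] (mod int p)" using inv_mod_cong ndy by (simp add: u_def)
      \<comment> \<open>The preimage of \<open>y\<close> under the substitution.\<close>
      define x where "x = (u + x0) mod int p"
      have xr: "x \<in> {0..<int p}" using p_gt_2 by (simp add: x_def)
      have xu: "[x - x0 = u] (mod int p)" by (simp add: x_def cong_def mod_simps)
      hence ndx: "\<not> int p dvd x - x0" using ndu by (simp add: cong_dvd_iff)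
      hence "x \<noteq> x0" by auto
      have "x \<notin> S"
      proof
        assume "x \<in> S"
        hence xS: "x \<in> S - {x0}" using \<open>x \<noteq> x0\<close> by simp
        have "[u * f x = 1] (mod int p)"
          using f1[OF xS] xu by (meson cong_scalar_right cong_sym cong_trans)
        hence "[y * (u * f x) = y] (mod int p)"
          using cong_scalar_left[of "u * f x" 1 "int p" y] by simp
        moreover have "[(y * u) * f x = f x] (mod int p)"
          using cong_scalar_right[OF yu, of "f x"] by simp
        ultimately have "[y = f x] (mod int p)"
          by (metis cong_sym cong_trans mult.assoc)
        moreover have "f x \<in> {0..<int p}" using inv_mod_range by (simp add: f_def)
        ultimately have "y = f x" using y dvd_diff_range[of y "f x"] by (simp add: cong_iff_dvd_diff)
        thus False using y(2) xS by blast
      qed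
      hence one: "chi_prod D x = 1" using off xr by blast
      have chiu: "chi u * chi u = 1" using ndu chi_cases[of u] chi_eq_0_iff[of u] by auto
      have chi_term: "chi (y - f d) = chi u * (chi (x - d) * chi (d - x0))" if d: "d \<in> E" for d
      proof -
        have dS: "d \<in> S - {x0}" using d ES by blast
        \<comment> \<open>This is 1/(x - x0) - 1/(d - x0) = (d - x)/((x - x0)(d - x0)) with
          denominators cleared.\<close>
        have "[(y * u) * (d - x0) - u * ((d - x0) * f d) = 1 * (d - x0) - u * 1] (mod int p)"
          by (intro cong_diff cong_mult cong_refl yu f1[OF dS])
        also have "[1 * (d - x0) - u * 1 = (d - x0) - (x - x0)] (mod int p)"
          using cong_diff[OF cong_refl[of "d - x0"] cong_sym[OF xu]] by simp
        also have "(d - x0) - (x - x0) = d - x" by simp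
        also have "(y * u) * (d - x0) - u * ((d - x0) * f d) = (y - f d) * (u * (d - x0))"
          by (simp add: algebra_simps)
        finally have "chi ((y - f d) * (u * (d - x0))) = chi (d - x)" by (rule chi_cong)
        hence e: "chi (y - f d) * (chi u * chi (d - x0)) = chi (x - d)"
          by (simp only: chi_mult chi_diff_commute[of d x])
        have "chi (d - x0) * chi (d - x0) = 1"
          using nd[OF dS] chi_cases[of "d - x0"] chi_eq_0_iff[of "d - x0"] by auto
        moreover have "chi u * (chi (y - f d) * (chi u * chi (d - x0)) * chi (d - x0))
            = (chi u * chi u) * (chi (d - x0) * chi (d - x0)) * chi (y - f d)"
          by (simp only: mult_ac)
        ultimately show ?thesis using chiu by (simp add: e)
      qed
      have "chi_prod (f ` E) y = chi u ^ card E * ((\<Prod>d\<in>E. chi (x - d)) * C)"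
        using chi_term by (simp add: cp C_def prod.distrib)
      \<comment> \<open>As \<open>card E\<close> is odd, one factor
        \<open>chi u = chi (x - x0)\<close> survives, which is the factor of
        \<open>chi_prod D x\<close> missing from the product over \<open>E\<close>.\<close>
      also have "chi u ^ card E = chi u"
        using cE(1) odd_pos[OF cE(1)] chi_cases[of u] by auto
      also have "chi u = chi (x - x0)" using chi_cong[OF xu] by simp
      also have "chi (x - x0) * ((\<Prod>d\<in>E. chi (x - d)) * C) = chi_prod D x * C"
        using finD x0 by (simp add: chi_prod_def E_def prod.remove[of D x0])
      finally show ?thesis using one by simp
    qed
  qed
  also have "card (f ` (S - {x0})) = card S - 1"
    using inj finS x0 D by (auto simp: card_image)
  finally show ?thesis .
qed

text \<open>Neighbours of \<open>x\<close> in \<open>D\<close> contribute 1 and the other elements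
  -1. The former are even in number, so the latter have the parity of \<open>card D\<close>.\<close>

lemma chi_prod_off_local_set:
  assumes D: "D \<subseteq> {0..<int p}"
    and x: "x \<in> {0..<int p}" "x \<notin> D \<union> odd_neighborhood (paley_graph p) D"
  shows "chi_prod D x = (- 1) ^ card D"
proof -
  let ?N = "neighborhood (paley_graph p) x"
  have fin: "finite D" using D finite_subset by blast
  have "chi (x - d) = (if d \<in> ?N then 1 else - 1)" if d: "d \<in> D" for d
  proof -
    have "x \<noteq> d" using d x by blast
    moreover have "\<not> int p dvd x - d" using dvd_diff_range[of x d] d D x calculation by blast
    moreover have "d \<in> ?N \<longleftrightarrow> {x, d} \<in> edges (paley_graph p)"
      using d D by (auto simp: neighborhood_def verts_paley_graph)
    ultimately show ?thesis
      using paley_adjacent_iff[OF prime p_mod_4, of x d] d D x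
      by (auto simp: Legendre_def cong_0_iff verts_paley_graph)
  qed
  hence "chi_prod D x = (\<Prod>d\<in>D. if d \<in> ?N then 1 else - 1)" by (simp add: chi_prod_def)
  also have "\<dots> = (- 1) ^ card (D - ?N)"
    using fin by (simp add: prod.If_cases Diff_eq)
  also have "\<dots> = (- 1) ^ card D"
  proof -
    have "even (card (?N \<inter> D))" using x by (auto simp: odd_neighborhood_def verts_paley_graph)
    moreover have "card D = card (D - ?N) + card (?N \<inter> D)"
      using fin by (metis Int_commute card_Int_Diff add.commute)
    ultimately show ?thesis by (simp add: power_add)
  qed
  finally show ?thesis .
qed

lemma card_local_set_ge:
  assumes D: "D \<subseteq> {0..<int p}" "D \<noteq> {}"
  shows "p \<le> card (D \<union> odd_neighborhood (paley_graph p) D) ^ 2"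
proof -
  let ?S = "D \<union> odd_neighborhood (paley_graph p) D"
  have S: "?S \<subseteq> {0..<int p}"
    using D by (auto simp: odd_neighborhood_def verts_paley_graph)
  show ?thesis
  proof (cases "even (card D)")
    case True
    \<comment> \<open>The even case yields one more than required, since the point sent to infinity
      is not counted.\<close>
    have "p \<le> (card ?S - 1) ^ 2"
      by (rule square_root_bound_even[OF S _ True D(2)])
         (use chi_prod_off_local_set[OF D(1)] True in auto)
    also have "\<dots> \<le> card ?S ^ 2" by (intro power_mono) auto
    finally show ?thesis .
  next
    case False
    show ?thesis
      by (rule square_root_bound_odd[OF S _ False, of "- 1"])
         (use chi_prod_off_local_set[OF D(1)] False in auto)
  qed
qed

end

theorem theorem1:
  fixes p :: nat
  assumes "prime p"
    and "[p = 1] (mod 4)"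
  shows "real (local_min_degree (paley_graph p)) \<ge> sqrt (real p) - 3 / 2"
proof -
  interpret paley_prime p using assms by unfold_locales
  have ne: "verts (paley_graph p) \<noteq> {}" using p_gt_2 by (simp add: verts_paley_graph)
  obtain D where D: "D \<subseteq> verts (paley_graph p)" "D \<noteq> {}"
    "card (D \<union> odd_neighborhood (paley_graph p) D) = local_min_degree (paley_graph p) + 1"
    using local_set_of_local_min_degree[OF finite_simple_graph_paley ne] .
  have "p \<le> (local_min_degree (paley_graph p) + 1) ^ 2"
    using card_local_set_ge[of D] D by (simp add: verts_paley_graph)
  hence "real p \<le> (real (local_min_degree (paley_graph p)) + 1) ^ 2"
    by (metis of_nat_1 of_nat_add of_nat_le_iff of_nat_power)
  hence "sqrt (real p) \<le> real (local_min_degree (paley_graph p)) + 1"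
    by (intro real_le_lsqrt) auto
  \<comment> \<open>The bound reached is \<open>sqrt p - 1\<close>, which implies the claim.\<close>
  thus ?thesis by simp
qed

end
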